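(* Let $r>1$ and let $U=(u_{ij})_{i,j\in\mathbb{Z}}$ be a matrix of $r\times r$ blocks depending on $\boldsymbol{x}=(x_0,x_1,\ldots)$ and $\boldsymbol{y}=(y_0,y_1,\ldots)$ that satisfies, for $k=1,2,\ldots$, $$\frac{\partial U}{\partial x_k}=\bigl(E_r\otimes\Lambda-U(E_r\otimes\mathcal{O}_1)\bigr)\frac{\partial U}{\partial x_{k-1}},\qquad \frac{\partial U}{\partial y_k}=\bigl(E_r\otimes\Lambda-U(E_r\otimes\mathcal{O}_1)\bigr)\frac{\partial U}{\partial y_{k-1}},$$ together with the constraint $(E_r\otimes\Lambda)U-U(E_r\otimes\Lambda^{-1})-U(E_r\otimes\mathcal{O}_1)U=0$. Let $\rho(z)$ be a $\mathrm{GL}(r)$-valued function of $z,\boldsymbol{x},\boldsymbol{y}$ satisfying $$\frac{\partial\rho(z)}{\partial x_k}-z\frac{\partial\rho(z)}{\partial x_{k-1}}=0,\qquad \frac{\partial\rho(z)}{\partial y_k}-z\frac{\partial\rho(z)}{\partial y_{k-1}}=0,\qquad k=1,2,\ldots.$$ Let $g=E-U(E_r\otimes\Omega)$, $\bar g=E-U(E_r\otimes\bar\Omega)$, $\boldsymbol{c}(z)=(E_rz^i)_{i\in\mathbb{Z}}$ and $\boldsymbol{u}(z)=g\boldsymbol{c}(z)\rho(z)$, $\bar{\boldsymbol{u}}(z)=\bar g\boldsymbol{c}(z)\rho(z)$. Then for $k=1,2,\ldots$ $$\frac{\partial\boldsymbol{u}(z)}{\partial x_k}=\bigl(E_r\otimes\Lambda-U(E_r\otimes\mathcal{O}_1)\bigr)\frac{\partial\boldsymbol{u}(z)}{\partial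 x_{k-1}},\qquad \frac{\partial\boldsymbol{u}(z)}{\partial y_k}=\bigl(E_r\otimes\Lambda-U(E_r\otimes\mathcal{O}_1)\bigr)\frac{\partial\boldsymbol{u}(z)}{\partial y_{k-1}},$$ $$\frac{\partial\bar{\boldsymbol{u}}(z)}{\partial x_k}=\bigl(E_r\otimes\Lambda-U(E_r\otimes\mathcal{O}_1)\bigr)\frac{\partial\bar{\boldsymbol{u}}(z)}{\partial x_{k-1}},\qquad \frac{\partial\bar{\boldsymbol{u}}(z)}{\partial y_k}=\bigl(E_r\otimes\Lambda-U(E_r\otimes\mathcal{O}_1)\bigr)\frac{\partial\bar{\boldsymbol{u}}(z)}{\partial y_{k-1}}.$$
   Context: $E_{ij}$ denotes the scalar $\mathbb{Z}\times\mathbb{Z}$ matrix unit, $E_r$ the $r\times r$ unit matrix, and $E$ the unit matrix with $r\times r$ blocks $\delta_{ij}E_r$. $\Lambda^{k}=\sum_{i\in\mathbb{Z}}E_{i,i+k}$, $\Lambda=\Lambda^1$, $\mathcal{O}_1=E_{0,0}$, $\Omega=\sum_{i=0}^\infty E_{i,-i-1}$, $\bar\Omega=-\sum_{i=0}^\infty E_{-i-1,i}$. For an $r\times r$ matrix $A$ and a scalar $\mathbb{Z}\times\mathbb{Z}$ matrix $B=(b_{ij})$, $A\otimes B$ is the block matrix with $(i,j)$ block $b_{ij}A$, so that $(A\otimes B)U=\bigl(\sum_kb_{ik}Au_{kj}\bigr)_{ij}$ and $U(A\otimes B)=\bigl(\sum_ku_{ik}Ab_{kj}\bigr)_{ij}$.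 $\boldsymbol{u}(z)$ and $\bar{\boldsymbol{u}}(z)$ are columns of $r\times r$ blocks, explicitly $u_i(z)=\bigl(E_rz^i-\sum_{j\ge0}u_{ij}z^{-j-1}\bigr)\rho(z)$ and $\bar u_i(z)=\bigl(E_rz^i+\sum_{j\ge0}u_{i,-j-1}z^{j}\bigr)\rho(z)$, understood as formal Laurent series in $z$ times the right factor $\rho(z)$, differentiated by the Leibniz rule. *)

theory Defs
  imports "HOL-Analysis.Analysis" "HOL-Library.Groups_Big_Fun"
    "HOL-Library.Function_Algebras" "HOL-Library.Poly_Mapping"
begin

section \<open>Block matrices indexed by the integers\<close>

definition mscale :: "'a::comm_ring_1 \<Rightarrow> 'a^'r^'r \<Rightarrow> 'a^'r^'r::finite" where
  "mscale s A = (\<chi> a b. s * A $ a $ b)"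

type_synonym 'a zmat = "int \<Rightarrow> int \<Rightarrow> 'a"

type_synonym ('a, 'r) bmat = "int \<Rightarrow> int \<Rightarrow> 'a^'r^'r"

definition Lambda :: "int \<Rightarrow> 'a::comm_ring_1 zmat" where
  "Lambda k i j = of_bool (j = i + k)"

definition Omat1 :: "'a::comm_ring_1 zmat" where
  "Omat1 i j = of_bool (i = 0 \<and> j = 0)"

definition Omega :: "'a::comm_ring_1 zmat" where
  "Omega i j = of_bool (i \<ge> 0 \<and> j = - i - 1)"

definition Omega_bar :: "'a::comm_ring_1 zmat" where
  "Omega_bar i j = - of_bool (j \<ge> 0 \<and> i = - j - 1)"

definition btensor :: "'a::comm_ring_1^'r^'r \<Rightarrow> 'a zmat \<Rightarrow> ('a, 'r::finite) bmat"
    (infixr "\<otimes>\<^sub>b" 75) where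
  "(A \<otimes>\<^sub>b B) i j = mscale (B i j) A"

text \<open>\<open>Sum_any\<close> sums over the finite support.  In every product formed below one factor has
  finitely many nonzero blocks in each row (if it is the left one) or in each column (if it is
  the right one), so the support is finite.\<close>

definition bmult :: "('a::comm_ring_1, 'r) bmat \<Rightarrow> ('a, 'r) bmat \<Rightarrow> ('a, 'r::finite) bmat"
    (infixl "\<odot>" 70) where
  "(A \<odot> B) i j = Sum_any (\<lambda>k. A i k ** B k j)"

definition bunit :: "('a::comm_ring_1, 'r::finite) bmat" where
  "bunit i j = (if i = j then mat 1 else 0)"

definition shift_op :: "('a::comm_ring_1, 'r::finite) bmat \<Rightarrow> ('a, 'r) bmat" where
  "shift_op U = mat 1 \<otimes>\<^sub>b Lambda 1 - U \<odot> (mat 1 \<otimes>\<^sub>b Omat1)"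

definition gmat :: "('a::comm_ring_1, 'r::finite) bmat \<Rightarrow> ('a, 'r) bmat" where
  "gmat U = bunit - U \<odot> (mat 1 \<otimes>\<^sub>b Omega)"

definition gmat_bar :: "('a::comm_ring_1, 'r::finite) bmat \<Rightarrow> ('a, 'r) bmat" where
  "gmat_bar U = bunit - U \<odot> (mat 1 \<otimes>\<^sub>b Omega_bar)"


section \<open>Formal series in the spectral parameter\<close>

text \<open>A formal series is given by its coefficients, \<open>L n\<close> being the coefficient of \<open>z ^ n\<close>.
  Two-sided series are allowed, so that one type contains the Laurent series in \<open>1 / z\<close>
  (needed for \<open>gmat\<close>) and those in \<open>z\<close> (needed for \<open>gmat_bar\<close>).\<close>

type_synonym ('a, 'r) fseries = "int \<Rightarrow> 'a^'r^'r"

definition fseries_shift :: "('a, 'r) fseries \<Rightarrow> ('a, 'r) fseries" where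
  "fseries_shift L = (\<lambda>n. L (n - 1))"

definition c_col :: "int \<Rightarrow> ('a::comm_ring_1, 'r::finite) fseries" where
  "c_col i = (\<lambda>n. if n = i then mat 1 else 0)"

definition bmult_col ::
    "('a::comm_ring_1, 'r) bmat \<Rightarrow> (int \<Rightarrow> ('a, 'r) fseries) \<Rightarrow> int \<Rightarrow> ('a, 'r::finite) fseries" where
  "bmult_col A v i = (\<lambda>n. Sum_any (\<lambda>k. A i k ** v k n))"


section \<open>Formal series times a matrix function of the spectral parameter\<close>

text \<open>Since the series need not converge, a product \<open>L(z) \<phi>(z)\<close> of a formal series and a function
  is an element of the tensor product over \<open>Mat\<^sub>r(K[z])\<close> of the right module of formal
  series and the left module of matrix functions of \<open>z\<close>: the free abelian group on pairs
  \<open>(L, \<phi>)\<close> modulo biadditivity and balancedness with respect to constant matrices and \<open>z\<close>,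
  which generate \<open>Mat\<^sub>r(K[z])\<close>.\<close>

inductive_set tensor_rel ::
    "(('a::comm_ring_1, 'r::finite) fseries \<times> ('a \<Rightarrow> 'a^'r^'r) \<Rightarrow>\<^sub>0 int) set" where
  zero: "0 \<in> tensor_rel"
| diff: "a \<in> tensor_rel \<Longrightarrow> b \<in> tensor_rel \<Longrightarrow> a - b \<in> tensor_rel"
| add_left: "frag_of (L + L', \<phi>) - frag_of (L, \<phi>) - frag_of (L', \<phi>) \<in> tensor_rel"
| add_right: "frag_of (L, \<phi> + \<phi>') - frag_of (L, \<phi>) - frag_of (L, \<phi>') \<in> tensor_rel"
| balanced_mat: "frag_of (\<lambda>n. L n ** A, \<phi>) - frag_of (L, \<lambda>z. A ** \<phi> z) \<in> tensor_rel"
| balanced_z: "frag_of (fseries_shift L, \<phi>) - frag_of (L, \<lambda>z. mscale z (\<phi> z)) \<in> tensor_rel"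

definition tensor_eq ::
    "(('a::comm_ring_1, 'r::finite) fseries \<times> ('a \<Rightarrow> 'a^'r^'r) \<Rightarrow>\<^sub>0 int) \<Rightarrow>
     (('a, 'r) fseries \<times> ('a \<Rightarrow> 'a^'r^'r) \<Rightarrow>\<^sub>0 int) \<Rightarrow> bool" where
  "tensor_eq a b \<longleftrightarrow> a - b \<in> tensor_rel"

lemma tensor_rel_uminus: "a \<in> tensor_rel \<Longrightarrow> - a \<in> tensor_rel"
  using tensor_rel.diff[OF tensor_rel.zero, of a] by simp

lemma tensor_rel_add: "a \<in> tensor_rel \<Longrightarrow> b \<in> tensor_rel \<Longrightarrow> a + b \<in> tensor_rel"
  using tensor_rel.diff[of a "- b"] tensor_rel_uminus[of b] by simp

lemma equivp_tensor_eq: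
  "equivp (tensor_eq ::
     (('a::comm_ring_1, 'r::finite) fseries \<times> ('a \<Rightarrow> 'a^'r^'r) \<Rightarrow>\<^sub>0 int) \<Rightarrow> _)"
proof (intro equivpI reflpI sympI transpI)
  show "tensor_eq a a" for a :: "('a, 'r) fseries \<times> ('a \<Rightarrow> 'a^'r^'r) \<Rightarrow>\<^sub>0 int"
    by (simp add: tensor_eq_def tensor_rel.zero)
next
  show "tensor_eq b a" if "tensor_eq a b"
    for a b :: "('a, 'r) fseries \<times> ('a \<Rightarrow> 'a^'r^'r) \<Rightarrow>\<^sub>0 int"
    using tensor_rel_uminus[of "a - b"] that by (simp add: tensor_eq_def)
next
  show "tensor_eq a c" if "tensor_eq a b" "tensor_eq b c"
    for a b c :: "('a, 'r) fseries \<times> ('a \<Rightarrow> 'a^'r^'r) \<Rightarrow>\<^sub>0 int"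
    using tensor_rel_add[of "a - b" "b - c"] that by (simp add: tensor_eq_def)
qed

quotient_type (overloaded) ('a, 'r) formal =
    "('a::comm_ring_1, 'r::finite) fseries \<times> ('a \<Rightarrow> 'a^'r^'r) \<Rightarrow>\<^sub>0 int" / tensor_eq
  by (rule equivp_tensor_eq)

instantiation formal :: (comm_ring_1, finite) ab_group_add
begin

lift_definition zero_formal :: "('a, 'b) formal" is 0 .

lift_definition plus_formal :: "('a, 'b) formal \<Rightarrow> ('a, 'b) formal \<Rightarrow> ('a, 'b) formal" is "(+)"
  unfolding tensor_eq_def by (simp add: add_diff_add tensor_rel_add)

lift_definition uminus_formal :: "('a, 'b) formal \<Rightarrow> ('a, 'b) formal" is uminus
  unfolding tensor_eq_def by (simp only: minus_diff_minus tensor_rel_uminus)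

lift_definition minus_formal :: "('a, 'b) formal \<Rightarrow> ('a, 'b) formal \<Rightarrow> ('a, 'b) formal" is "(-)"
  unfolding tensor_eq_def
proof -
  fix a b c d :: "('a, 'b) fseries \<times> ('a \<Rightarrow> 'a^'b^'b) \<Rightarrow>\<^sub>0 int"
  assume "a - b \<in> tensor_rel" "c - d \<in> tensor_rel"
  then have "(a - b) - (c - d) \<in> tensor_rel"
    by (rule tensor_rel.diff)
  then show "a - c - (b - d) \<in> tensor_rel"
    by (simp add: algebra_simps)
qed

instance
proof
  fix a b c :: "('a, 'b) formal"
  show "a + b + c = a + (b + c)"
    by transfer (simp add: add.assoc tensor_eq_def tensor_rel.zero)
  show "a + b = b + a"
    by transfer (simp add: add.commute tensor_eq_def tensor_rel.zero)
  show "0 + a = a"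
    by transfer (simp add: tensor_eq_def tensor_rel.zero)
  show "- a + a = 0"
    by transfer (simp add: tensor_eq_def tensor_rel.zero)
  show "a - b = a + - b"
    by transfer (simp add: tensor_eq_def tensor_rel.zero)
qed

end

text \<open>\<open>Z\<close> is the domain of \<open>\<phi>\<close>; the values outside \<open>Z\<close> are discarded.\<close>

lift_definition formal_prod ::
    "'a set \<Rightarrow> ('a::comm_ring_1, 'r::finite) fseries \<Rightarrow> ('a \<Rightarrow> 'a^'r^'r) \<Rightarrow> ('a, 'r) formal"
  is "\<lambda>Z L \<phi>. frag_of (L, \<lambda>z. if z \<in> Z then \<phi> z else 0)" .

lemma frag_extend_lmult_tensor_rel:
  assumes "a \<in> tensor_rel"
  shows "frag_extend (\<lambda>(L, \<phi>). frag_of (\<lambda>n. A ** L n, \<phi>)) a \<in> tensor_rel"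
  using assms
proof induction
  case zero
  show ?case by (simp add: tensor_rel.zero)
next
  case (diff a b)
  then show ?case by (simp add: frag_extend_diff tensor_rel.diff)
next
  case (add_left L L' \<phi>)
  have "(\<lambda>n. A ** (L + L') n) = (\<lambda>n. A ** L n) + (\<lambda>n. A ** L' n)"
    by (simp add: fun_eq_iff matrix_add_ldistrib)
  then show ?case by (simp add: frag_extend_diff tensor_rel.add_left)
next
  case (add_right L \<phi> \<phi>')
  show ?case by (simp add: frag_extend_diff tensor_rel.add_right)
next
  case (balanced_mat L B \<phi>)
  show ?case
    using tensor_rel.balanced_mat[of "\<lambda>n. A ** L n" B \<phi>]
    by (simp add: frag_extend_diff matrix_mul_assoc)
next
  case (balanced_z L \<phi>)
  show ?case
    using tensor_rel.balanced_z[of "\<lambda>n. A ** L n" \<phi>]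
    by (simp add: frag_extend_diff fseries_shift_def)
qed

lift_definition formal_lmult ::
    "'a::comm_ring_1^'r^'r \<Rightarrow> ('a, 'r::finite) formal \<Rightarrow> ('a, 'r) formal"
  is "\<lambda>A. frag_extend (\<lambda>(L, \<phi>). frag_of (\<lambda>n. A ** L n, \<phi>))"
  unfolding tensor_eq_def by (simp only: frag_extend_diff[symmetric] frag_extend_lmult_tensor_rel)

lemma formal_lmult_prod:
  "formal_lmult A (formal_prod Z L \<phi>) = formal_prod Z (\<lambda>n. A ** L n) \<phi>"
  by transfer (simp add: tensor_eq_def tensor_rel.zero)

definition bmult_formal ::
    "('a::comm_ring_1, 'r) bmat \<Rightarrow> (int \<Rightarrow> ('a, 'r) formal) \<Rightarrow> int \<Rightarrow> ('a, 'r::finite) formal" where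
  "bmult_formal A w i = Sum_any (\<lambda>k. formal_lmult (A i k) (w k))"


section \<open>Partial derivatives\<close>

type_synonym 'a point = "(nat \<Rightarrow> 'a) \<times> (nat \<Rightarrow> 'a)"

text \<open>Openness along every coordinate line, which is all that partial derivatives require.\<close>

definition coord_open :: "'a::topological_space point set \<Rightarrow> bool" where
  "coord_open D \<longleftrightarrow> (\<forall>(x, y)\<in>D. \<forall>k.
     (\<forall>\<^sub>F t in nhds (x k). (x(k := t), y) \<in> D) \<and> (\<forall>\<^sub>F t in nhds (y k). (x, y(k := t)) \<in> D))"

definition differentiable_xy :: "('a::real_normed_field point \<Rightarrow> 'a^'r^'r) \<Rightarrow> 'a point \<Rightarrow> bool" where
  "differentiable_xy f = (\<lambda>(x, y). \<forall>k a b.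
     (\<lambda>t. f (x(k := t), y) $ a $ b) field_differentiable at (x k) \<and>
     (\<lambda>t. f (x, y(k := t)) $ a $ b) field_differentiable at (y k))"

definition pdx :: "nat \<Rightarrow> ('a::real_normed_field point \<Rightarrow> 'a^'r^'r) \<Rightarrow> 'a point \<Rightarrow> 'a^'r^'r" where
  "pdx k f = (\<lambda>(x, y). \<chi> a b. deriv (\<lambda>t. f (x(k := t), y) $ a $ b) (x k))"

definition pdy :: "nat \<Rightarrow> ('a::real_normed_field point \<Rightarrow> 'a^'r^'r) \<Rightarrow> 'a point \<Rightarrow> 'a^'r^'r" where
  "pdy k f = (\<lambda>(x, y). \<chi> a b. deriv (\<lambda>t. f (x, y(k := t)) $ a $ b) (y k))"

text \<open>In the following two definitions \<open>d\<close> is one of the partial derivatives \<open>pdx k\<close>, \<open>pdy k\<close>.\<close>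

definition bderiv ::
    "(('a point \<Rightarrow> 'a^'r^'r) \<Rightarrow> 'a point \<Rightarrow> 'a^'r^'r) \<Rightarrow> ('a point \<Rightarrow> ('a, 'r) bmat) \<Rightarrow>
     'a point \<Rightarrow> ('a, 'r) bmat" where
  "bderiv d U p i j = d (\<lambda>q. U q i j) p"

text \<open>The Leibniz rule \<open>d(L \<rho>) = (d L) \<rho> + L (d \<rho>)\<close>, in each entry of a column \<open>v\<close> of series
  with coefficients depending on the point, multiplied by the common right factor \<open>\<rho>\<close>.\<close>

definition leibniz ::
    "'a set \<Rightarrow> (('a point \<Rightarrow> 'a^'r^'r) \<Rightarrow> 'a point \<Rightarrow> 'a^'r^'r) \<Rightarrow>
     ('a point \<Rightarrow> int \<Rightarrow> ('a, 'r) fseries) \<times> ('a \<Rightarrow> 'a point \<Rightarrow> 'a^'r^'r) \<Rightarrow>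
     'a point \<Rightarrow> int \<Rightarrow> ('a::comm_ring_1, 'r::finite) formal" where
  "leibniz Z d = (\<lambda>(v, \<rho>) p i.
     formal_prod Z (\<lambda>n. d (\<lambda>q. v q i n) p) (\<lambda>z. \<rho> z p) +
     formal_prod Z (v p i) (\<lambda>z. d (\<rho> z) p))"

definition u_col ::
    "('a::comm_ring_1 point \<Rightarrow> ('a, 'r::finite) bmat) \<Rightarrow> ('a \<Rightarrow> 'a point \<Rightarrow> 'a^'r^'r) \<Rightarrow>
     ('a point \<Rightarrow> int \<Rightarrow> ('a, 'r) fseries) \<times> ('a \<Rightarrow> 'a point \<Rightarrow> 'a^'r^'r)" where
  "u_col U \<rho> = (\<lambda>p. bmult_col (gmat (U p)) c_col, \<rho>)"

definition u_bar_col ::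
    "('a::comm_ring_1 point \<Rightarrow> ('a, 'r::finite) bmat) \<Rightarrow> ('a \<Rightarrow> 'a point \<Rightarrow> 'a^'r^'r) \<Rightarrow>
     ('a point \<Rightarrow> int \<Rightarrow> ('a, 'r) fseries) \<times> ('a \<Rightarrow> 'a point \<Rightarrow> 'a^'r^'r)" where
  "u_bar_col U \<rho> = (\<lambda>p. bmult_col (gmat_bar (U p)) c_col, \<rho>)"


section \<open>Explicit form of the two columns\<close>

lemma Sum_any_single:
  assumes "\<And>k. k \<noteq> m \<Longrightarrow> f k = 0"
  shows "Sum_any f = f m"
proof -
  have "Sum_any f = sum f {m}"
    by (rule Sum_any.expand_superset) (use assms in auto)
  then show ?thesis by simp
qed

lemma matrix_mult_zero [simp]:
  "(A :: 'a::comm_ring_1^'r^'r::finite) ** 0 = 0" "0 ** A = 0"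
  by (simp_all add: matrix_matrix_mult_def vec_eq_iff)

lemma mscale_simps [simp]: "mscale 0 A = 0" "mscale 1 A = A" "mscale (- s) A = - mscale s A"
  by (simp_all add: mscale_def vec_eq_iff)

lemma bmult_col_c_col: "bmult_col A c_col i n = A i n"
  unfolding bmult_col_def c_col_def by (subst Sum_any_single[of n]) auto

lemma gmat_column:
  "bmult_col (gmat U) c_col i n =
     (if n = i then mat 1 else 0) - (if n < 0 then U i (- n - 1) else 0)"
proof -
  have "(U \<odot> (mat 1 \<otimes>\<^sub>b Omega)) i n = (if n < 0 then U i (- n - 1) else 0)"
    unfolding bmult_def btensor_def Omega_def
    by (subst Sum_any_single[of "- n - 1"]) (auto simp: of_bool_def)
  then show ?thesis
    by (simp add: bmult_col_c_col gmat_def bunit_def eq_commute)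
qed

lemma gmat_bar_column:
  "bmult_col (gmat_bar U) c_col i n =
     (if n = i then mat 1 else 0) + (if n \<ge> 0 then U i (- n - 1) else 0)"
proof -
  have neg: "A ** (- B) = - (A ** B)" for A B :: "'a^'b^'b"
    by (simp add: matrix_matrix_mult_def vec_eq_iff sum_negf)
  have "(U \<odot> (mat 1 \<otimes>\<^sub>b Omega_bar)) i n = - (if n \<ge> 0 then U i (- n - 1) else 0)"
    unfolding bmult_def btensor_def Omega_bar_def
    by (subst Sum_any_single[of "- n - 1"]) (auto simp: of_bool_def neg)
  then show ?thesis
    by (simp add: bmult_col_c_col gmat_bar_def bunit_def eq_commute)
qed

end

theory Submission
  imports Defs
begin

text \<open>Write \<open>S = shift_op U\<close>.  Both columns \<open>v = gmat U c(z)\<close> and \<open>v = gmat_bar U c(z)\<close> satisfy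
  \<open>z v = S v\<close>: read coefficientwise, this is the constraint on \<open>U\<close>.  The coefficients of \<open>v\<close> differ
  from blocks of \<open>U\<close>, up to sign, by constants, so \<open>\<partial>\<^sub>k v = S \<partial>\<^sub>k\<^sub>-\<^sub>1 v\<close>.  As
  \<open>\<partial>\<^sub>k \<rho> = z \<partial>\<^sub>k\<^sub>-\<^sub>1 \<rho>\<close> and \<open>z\<close> can be moved across the formal product, the Leibniz rule gives
  \<open>\<partial>\<^sub>k (v \<rho>) = (S \<partial>\<^sub>k\<^sub>-\<^sub>1 v) \<rho> + (z v) \<partial>\<^sub>k\<^sub>-\<^sub>1 \<rho> = S \<partial>\<^sub>k\<^sub>-\<^sub>1 (v \<rho>)\<close>.\<close>

lemma matrix_diff_rdistrib:
  fixes A B C :: "'a::comm_ring_1^'r^'r::finite"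
  shows "(A - B) ** C = A ** C - B ** C"
  by (simp add: matrix_matrix_mult_def vec_eq_iff left_diff_distrib sum_subtractf)

lemma matrix_diff_ldistrib:
  fixes A B C :: "'a::comm_ring_1^'r^'r::finite"
  shows "A ** (B - C) = A ** B - A ** C"
  by (simp add: matrix_matrix_mult_def vec_eq_iff right_diff_distrib sum_subtractf)

lemma matrix_mult_minus:
  fixes A B :: "'a::comm_ring_1^'r^'r::finite"
  shows "A ** (- B) = - (A ** B)"
  using matrix_diff_ldistrib[of A 0 B] by simp


section \<open>The formal product\<close>

lemma formal_prod_add_left:
  "formal_prod Z (L + L') \<phi> = formal_prod Z L \<phi> + formal_prod Z L' \<phi>"
proof (transfer, unfold tensor_eq_def)
  fix Z :: "'a set" and L L' :: "('a, 'b) fseries" and \<phi> :: "'a \<Rightarrow> 'a^'b^'b"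
  let ?\<phi> = "\<lambda>z. if z \<in> Z then \<phi> z else 0"
  show "frag_of (L + L', ?\<phi>) - (frag_of (L, ?\<phi>) + frag_of (L', ?\<phi>)) \<in> tensor_rel"
    using tensor_rel.add_left[of L L' ?\<phi>] by (simp add: diff_diff_eq)
qed

lemma formal_prod_diff_left:
  "formal_prod Z (L - L') \<phi> = formal_prod Z L \<phi> - formal_prod Z L' \<phi>"
  using formal_prod_add_left[of Z "L - L'" L' \<phi>] by simp

text \<open>This moves a scalar factor \<open>z\<close> from the function to the series, by
  \<open>balanced_z\<close>. The relation is only required on \<open>Z\<close>: elsewhere both
  functions are cut off to 0, and \<open>mscale z 0 = 0\<close>.\<close>

lemma formal_prod_mscale:
  assumes "\<And>z. z \<in> Z \<Longrightarrow> \<psi> z = mscale z (\<phi> z)"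
  shows "formal_prod Z L \<psi> = formal_prod Z (fseries_shift L) \<phi>"
  using assms
proof (transfer, unfold tensor_eq_def)
  fix Z :: "'a set" and L :: "('a, 'b) fseries" and \<phi> \<psi> :: "'a \<Rightarrow> 'a^'b^'b"
  let ?\<phi> = "\<lambda>z. if z \<in> Z then \<phi> z else 0"
  assume "\<And>z. z \<in> Z \<Longrightarrow> \<psi> z = mscale z (\<phi> z)"
  then have "(\<lambda>z. if z \<in> Z then \<psi> z else 0) = (\<lambda>z. mscale z (?\<phi> z))"
    by (auto simp: mscale_def vec_eq_iff)
  then show "frag_of (L, \<lambda>z. if z \<in> Z then \<psi> z else 0) - frag_of (fseries_shift L, ?\<phi>) \<in> tensor_rel"
    using tensor_rel_uminus[OF tensor_rel.balanced_z[of L ?\<phi>]] by simp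
qed

lemma formal_lmult_add_right:
  "formal_lmult A (w + w') = formal_lmult A w + formal_lmult A w'"
  by transfer (simp add: frag_extend_add tensor_eq_def tensor_rel.zero)

text \<open>On representatives the two sides differ: a generator with series
  \<open>(A - B) L\<close> is not a difference of generators. They agree only modulo
  \<open>add_left\<close>, hence the induction over the free abelian group. This is the additivity
  that \<open>Sum_any_shift_op\<close> asks for.\<close>

lemma formal_lmult_diff_left:
  "formal_lmult (A - B) w = formal_lmult A w - formal_lmult B w"
proof (transfer, unfold tensor_eq_def)
  fix A B :: "'a^'b^'b" and w :: "('a, 'b) fseries \<times> ('a \<Rightarrow> 'a^'b^'b) \<Rightarrow>\<^sub>0 int"
  define l :: "'a^'b^'b \<Rightarrow> ('a, 'b) fseries \<times> ('a \<Rightarrow> 'a^'b^'b) \<Rightarrow> ('a, 'b) fseries \<times> ('a \<Rightarrow> 'a^'b^'b) \<Rightarrow>\<^sub>0 int"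
    where "l A = (\<lambda>(L, \<phi>). frag_of (\<lambda>n. A ** L n, \<phi>))" for A
  have "frag_extend (l (A - B)) w - (frag_extend (l A) w - frag_extend (l B) w) \<in> tensor_rel"
  proof (induction w rule: frag_induction[OF subset_UNIV])
    case 1
    show ?case
      by (simp add: tensor_rel.zero)
  next
    case (2 x)
    obtain L \<phi> where x: "x = (L, \<phi>)"
      by fastforce
    \<comment> \<open>Written as a sum, since the relation on series is stated for sums.\<close>
    have "(\<lambda>n. (A - B) ** L n) + (\<lambda>n. B ** L n) = (\<lambda>n. A ** L n)"
      by (simp add: fun_eq_iff matrix_diff_rdistrib)
    then show ?case
      using tensor_rel_uminus[OF tensor_rel.add_left[of "\<lambda>n. (A - B) ** L n" "\<lambda>n. B ** L n" \<phi>]]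
      by (simp add: l_def x) (simp add: diff_diff_eq2 add.commute)
  next
    case (3 a b)
    from tensor_rel.diff[OF this]
    show ?case
      by (simp add: frag_extend_diff algebra_simps)
  qed
  then show "frag_extend (\<lambda>(L, \<phi>). frag_of (\<lambda>n. (A - B) ** L n, \<phi>)) w
      - (frag_extend (\<lambda>(L, \<phi>). frag_of (\<lambda>n. A ** L n, \<phi>)) w
        - frag_extend (\<lambda>(L, \<phi>). frag_of (\<lambda>n. B ** L n, \<phi>)) w) \<in> tensor_rel"
    by (simp add: l_def)
qed

lemma formal_lmult_one: "formal_lmult (mat 1) w = w"
proof (transfer, unfold tensor_eq_def)
  fix w :: "('a, 'b) fseries \<times> ('a \<Rightarrow> 'a^'b^'b) \<Rightarrow>\<^sub>0 int"
  have "(\<lambda>(L :: ('a, 'b) fseries, \<phi> :: 'a \<Rightarrow> 'a^'b^'b). frag_of (\<lambda>n. mat 1 ** L n, \<phi>)) = frag_of"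
    by auto
  then have "frag_extend (\<lambda>(L, \<phi>). frag_of (\<lambda>n. mat 1 ** L n, \<phi>)) w = w"
    by (simp flip: frag_expansion)
  then show "frag_extend (\<lambda>(L, \<phi>). frag_of (\<lambda>n. mat 1 ** L n, \<phi>)) w - w \<in> tensor_rel"
    by (simp add: tensor_rel.zero)
qed


section \<open>The operator \<open>shift_op\<close>\<close>

lemma bmult_btensor_Omat1:
  "(U \<odot> (mat 1 \<otimes>\<^sub>b Omat1)) i j = (if j = 0 then U i 0 else 0)"
  unfolding bmult_def btensor_def Omat1_def
  by (subst Sum_any_single[of 0]) auto

lemma bmult_btensor_Lambda:
  "(U \<odot> (mat 1 \<otimes>\<^sub>b Lambda m)) i j = U i (j - m)"
  unfolding bmult_def btensor_def Lambda_def
  by (subst Sum_any_single[of "j - m"]) auto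

lemma btensor_Lambda_bmult:
  "((mat 1 \<otimes>\<^sub>b Lambda m) \<odot> U) i j = U (i + m) j"
  unfolding bmult_def btensor_def Lambda_def
  by (subst Sum_any_single[of "i + m"]) auto

lemma shift_op_apply:
  "shift_op U i k = (if k = i + 1 then mat 1 else 0) - (if k = 0 then U i 0 else 0)"
  by (simp add: shift_op_def bmult_btensor_Omat1 btensor_def Lambda_def)

text \<open>At \<open>i = - 1\<close> the two nonzero blocks of row \<open>i\<close> coincide, whence the additivity hypothesis.\<close>

lemma Sum_any_shift_op:
  fixes f :: "'a::comm_ring_1^'r^'r::finite \<Rightarrow> int \<Rightarrow> 'b::ab_group_add"
  assumes diff: "\<And>A B k. f (A - B) k = f A k - f B k"
  shows "Sum_any (\<lambda>k. f (shift_op U i k) k) = f (mat 1) (i + 1) - f (U i 0) 0"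
proof -
  have zero: "f 0 k = 0" for k
    using diff[of 0 0] by simp
  have split: "f (shift_op U i k) k
      = (if k = i + 1 then f (mat 1) k else 0) - (if k = 0 then f (U i 0) k else 0)" for k
    by (simp add: shift_op_apply diff zero)
  \<comment> \<open>The set may have one element. Each summand of \<open>split\<close> is a delta on
    it and is summed separately, so this causes no loss.\<close>
  have "Sum_any (\<lambda>k. f (shift_op U i k) k) = (\<Sum>k\<in>{0, i + 1}. f (shift_op U i k) k)"
    by (rule Sum_any.expand_superset) (auto simp: split)
  also have "\<dots> = f (mat 1) (i + 1) - f (U i 0) 0"
    unfolding split sum_subtractf by (subst (1 2) sum.delta) auto
  finally show ?thesis .
qed

lemma shift_op_bmult: "(shift_op U \<odot> A) i j = A (i + 1) j - U i 0 ** A 0 j"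
  unfolding bmult_def
  by (subst Sum_any_shift_op[where f = "\<lambda>B k. B ** A k j"]) (simp_all add: matrix_diff_rdistrib)

lemma shift_op_bmult_formal:
  "bmult_formal (shift_op U) w i = w (i + 1) - formal_lmult (U i 0) (w 0)"
  unfolding bmult_formal_def
  by (subst Sum_any_shift_op[where f = "\<lambda>B k. formal_lmult B (w k)"])
    (simp_all add: formal_lmult_diff_left formal_lmult_one)

text \<open>The common core for both columns and both families of variables: \<open>coeff\<close> is
  the evolution of the series, \<open>shift\<close> is \<open>z v = S v\<close> read off at
  \<open>z ^ n\<close>, and the last hypothesis is the evolution of \<rho>.\<close>

lemma shift_op_leibniz:
  assumes coeff: "\<And>i n. d (\<lambda>q. v q i n) p = d' (\<lambda>q. v q (i + 1) n) p - U i 0 ** d' (\<lambda>q. v q 0 n) p"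
    and shift: "\<And>i n. v p i (n - 1) = v p (i + 1) n - U i 0 ** v p 0 n"
    and \<rho>: "\<And>z. z \<in> Z \<Longrightarrow> d (\<rho> z) p = mscale z (d' (\<rho> z) p)"
  shows "leibniz Z d (v, \<rho>) p = bmult_formal (shift_op U) (leibniz Z d' (v, \<rho>) p)"
proof
  fix i
  let ?K = "\<lambda>i n. d' (\<lambda>q. v q i n) p" and ?\<rho> = "\<lambda>z. \<rho> z p" and ?\<phi> = "\<lambda>z. d' (\<rho> z) p"
  have "leibniz Z d (v, \<rho>) p i
      = formal_prod Z (\<lambda>n. d (\<lambda>q. v q i n) p) ?\<rho> + formal_prod Z (fseries_shift (v p i)) ?\<phi>"
    by (simp add: leibniz_def formal_prod_mscale[OF \<rho>])
  also have "(\<lambda>n. d (\<lambda>q. v q i n) p) = ?K (i + 1) - (\<lambda>n. U i 0 ** ?K 0 n)"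
    by (simp add: coeff fun_eq_iff)
  also have "fseries_shift (v p i) = v p (i + 1) - (\<lambda>n. U i 0 ** v p 0 n)"
    by (simp add: shift fseries_shift_def fun_eq_iff)
  also have "formal_prod Z (?K (i + 1) - (\<lambda>n. U i 0 ** ?K 0 n)) ?\<rho>
        + formal_prod Z (v p (i + 1) - (\<lambda>n. U i 0 ** v p 0 n)) ?\<phi>
      = bmult_formal (shift_op U) (leibniz Z d' (v, \<rho>) p) i"
    by (simp add: shift_op_bmult_formal leibniz_def formal_prod_diff_left formal_lmult_add_right
        formal_lmult_prod)
  finally show "leibniz Z d (v, \<rho>) p i = bmult_formal (shift_op U) (leibniz Z d' (v, \<rho>) p) i" .
qed

text \<open>\<open>Omat1\<close> leaves only the middle index 0 in the quadratic term, and
  \<open>Lambda (- 1)\<close> on the right raises the column index by one.\<close>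

lemma constraint_entry:
  assumes "(mat 1 \<otimes>\<^sub>b Lambda 1) \<odot> U - U \<odot> (mat 1 \<otimes>\<^sub>b Lambda (- 1))
      - U \<odot> (mat 1 \<otimes>\<^sub>b Omat1) \<odot> U = 0"
  shows "U i (j + 1) = U (i + 1) j - U i 0 ** U 0 j"
proof -
  have "(U \<odot> (mat 1 \<otimes>\<^sub>b Omat1) \<odot> U) i j = U i 0 ** U 0 j"
    unfolding bmult_def[of "U \<odot> (mat 1 \<otimes>\<^sub>b Omat1)"]
    by (subst Sum_any_single[of 0]) (simp_all add: bmult_btensor_Omat1)
  then show ?thesis
    using fun_cong[OF fun_cong[OF assms, of i], of j]
    by (simp add: bmult_btensor_Lambda btensor_Lambda_bmult algebra_simps)
qed


section \<open>Differentiation of the columns\<close>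

lemma pdx_const: "pdx k (\<lambda>q. C) p = 0"
  by (cases p) (simp add: pdx_def vec_eq_iff DERIV_imp_deriv)

lemma pdx_const_add: "differentiable_xy f p \<Longrightarrow> pdx k (\<lambda>q. C + f q) p = pdx k f p"
  by (cases p) (auto simp: pdx_def differentiable_xy_def vec_eq_iff field_differentiable_derivI
      intro!: DERIV_imp_deriv derivative_eq_intros)

lemma pdx_const_diff: "differentiable_xy f p \<Longrightarrow> pdx k (\<lambda>q. C - f q) p = - pdx k f p"
  by (cases p) (auto simp: pdx_def differentiable_xy_def vec_eq_iff field_differentiable_derivI
      intro!: DERIV_imp_deriv derivative_eq_intros)

lemma pdy_const: "pdy k (\<lambda>q. C) p = 0"
  by (cases p) (simp add: pdy_def vec_eq_iff DERIV_imp_deriv)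

lemma pdy_const_add: "differentiable_xy f p \<Longrightarrow> pdy k (\<lambda>q. C + f q) p = pdy k f p"
  by (cases p) (auto simp: pdy_def differentiable_xy_def vec_eq_iff field_differentiable_derivI
      intro!: DERIV_imp_deriv derivative_eq_intros)

lemma pdy_const_diff: "differentiable_xy f p \<Longrightarrow> pdy k (\<lambda>q. C - f q) p = - pdy k f p"
  by (cases p) (auto simp: pdy_def differentiable_xy_def vec_eq_iff field_differentiable_derivI
      intro!: DERIV_imp_deriv derivative_eq_intros)

text \<open>With \<open>d\<close> and \<open>d'\<close> abstract, the x and y equations need one
  proof. The rules for constants and for constants plus or minus a block cover every coefficient in
  \<open>gmat_column\<close> and \<open>gmat_bar_column\<close>.\<close>

lemma leibniz_u_col:
  assumes const: "\<And>C. d (\<lambda>q. C) p = 0" "\<And>C. d' (\<lambda>q. C) p = 0"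
    and add: "\<And>C i j. d (\<lambda>q. C + U q i j) p = d (\<lambda>q. U q i j) p"
      "\<And>C i j. d' (\<lambda>q. C + U q i j) p = d' (\<lambda>q. U q i j) p"
    and diff: "\<And>C i j. d (\<lambda>q. C - U q i j) p = - d (\<lambda>q. U q i j) p"
      "\<And>C i j. d' (\<lambda>q. C - U q i j) p = - d' (\<lambda>q. U q i j) p"
    and U: "bderiv d U p = shift_op (U p) \<odot> bderiv d' U p"
    and constraint: "(mat 1 \<otimes>\<^sub>b Lambda 1) \<odot> U p - U p \<odot> (mat 1 \<otimes>\<^sub>b Lambda (- 1))
      - U p \<odot> (mat 1 \<otimes>\<^sub>b Omat1) \<odot> U p = 0"
    and \<rho>: "\<And>z. z \<in> Z \<Longrightarrow> d (\<rho> z) p = mscale z (d' (\<rho> z) p)"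
  shows "leibniz Z d (u_col U \<rho>) p = bmult_formal (shift_op (U p)) (leibniz Z d' (u_col U \<rho>) p)"
    and "leibniz Z d (u_bar_col U \<rho>) p
      = bmult_formal (shift_op (U p)) (leibniz Z d' (u_bar_col U \<rho>) p)"
proof -
  have dU: "d (\<lambda>q. U q i j) p = d' (\<lambda>q. U q (i + 1) j) p - U p i 0 ** d' (\<lambda>q. U q 0 j) p" for i j
    using fun_cong[OF fun_cong[OF U, of i], of j] by (simp add: shift_op_bmult bderiv_def)
  \<comment> \<open>Column \<open>- n - 1\<close> of \<open>U\<close> sits at \<open>z ^ n\<close>,
    so this is the constraint in terms of the exponent.\<close>
  have rec: "U p i (- n) = U p (i + 1) (- n - 1) - U p i 0 ** U p 0 (- n - 1)" for i n
    using constraint_entry[OF constraint, of i "- n - 1"] by simp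
  show "leibniz Z d (u_col U \<rho>) p = bmult_formal (shift_op (U p)) (leibniz Z d' (u_col U \<rho>) p)"
    unfolding u_col_def
  proof (rule shift_op_leibniz[where d = d and d' = d' and p = p and \<rho> = \<rho>, OF _ _ \<rho>])
    show "d (\<lambda>q. bmult_col (gmat (U q)) c_col i n) p =
        d' (\<lambda>q. bmult_col (gmat (U q)) c_col (i + 1) n) p
          - U p i 0 ** d' (\<lambda>q. bmult_col (gmat (U q)) c_col 0 n) p" for i n
      \<comment> \<open>In row 0 a negative exponent has no unit block, so the simplifier meets
        \<open>- U\<close> instead of \<open>C - U\<close>.\<close>
      by (cases "n < 0") (simp_all add: gmat_column const diff diff(2)[of 0, simplified] dU matrix_mult_minus)
    show "bmult_col (gmat (U p)) c_col i (n - 1) =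
        bmult_col (gmat (U p)) c_col (i + 1) n - U p i 0 ** bmult_col (gmat (U p)) c_col 0 n" for i n
    \<comment> \<open>The constraint enters only for negative \<open>n\<close>. At
      \<open>n = 0\<close> the block \<open>- U p i 0\<close> on the left matches the product of
      \<open>U p i 0\<close> with the unit block of row 0.\<close>
    proof (cases n "0::int" rule: linorder_cases)
      case less
      then show ?thesis by (simp add: gmat_column rec matrix_mult_minus matrix_diff_ldistrib)
    qed (simp_all add: gmat_column)
  qed
  show "leibniz Z d (u_bar_col U \<rho>) p
      = bmult_formal (shift_op (U p)) (leibniz Z d' (u_bar_col U \<rho>) p)"
    unfolding u_bar_col_def
  proof (rule shift_op_leibniz[where d = d and d' = d' and p = p and \<rho> = \<rho>, OF _ _ \<rho>])
    show "d (\<lambda>q. bmult_col (gmat_bar (U q)) c_col i n) p =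
        d' (\<lambda>q. bmult_col (gmat_bar (U q)) c_col (i + 1) n) p
          - U p i 0 ** d' (\<lambda>q. bmult_col (gmat_bar (U q)) c_col 0 n) p" for i n
      by (cases "n < 0") (simp_all add: gmat_bar_column const add dU)
    show "bmult_col (gmat_bar (U p)) c_col i (n - 1) = bmult_col (gmat_bar (U p)) c_col (i + 1) n
        - U p i 0 ** bmult_col (gmat_bar (U p)) c_col 0 n" for i n
    \<comment> \<open>At \<open>n = 0\<close> the left side has no block of \<open>U\<close> (its
      exponent is -1), and the constraint at column -1 makes those on the right cancel. For positive
      \<open>n\<close> it matches them term by term.\<close>
    proof (cases n "0::int" rule: linorder_cases)
      case equal
      then show ?thesis
        using rec[of i 0] by (simp add: gmat_bar_column matrix_add_ldistrib algebra_simps)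
    next
      case greater
      then show ?thesis by (simp add: gmat_bar_column rec algebra_simps)
    qed (simp_all add: gmat_bar_column)
  qed
qed

theorem proposition14:
  fixes U :: "'a::real_normed_field point \<Rightarrow> ('a, 'r::finite) bmat"
    and \<rho> :: "'a \<Rightarrow> 'a point \<Rightarrow> 'a^'r^'r"
    and D :: "'a point set" and Z :: "'a set"
  assumes "CARD('r) > 1"
    and "coord_open D"
    and "\<And>p i j. p \<in> D \<Longrightarrow> differentiable_xy (\<lambda>q. U q i j) p"
    and "\<And>p k. p \<in> D \<Longrightarrow> k \<ge> 1 \<Longrightarrow>
           bderiv (pdx k) U p = shift_op (U p) \<odot> bderiv (pdx (k - 1)) U p"
    and "\<And>p k. p \<in> D \<Longrightarrow> k \<ge> 1 \<Longrightarrow>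
           bderiv (pdy k) U p = shift_op (U p) \<odot> bderiv (pdy (k - 1)) U p"
    and "\<And>p. p \<in> D \<Longrightarrow>
           (mat 1 \<otimes>\<^sub>b Lambda 1) \<odot> U p - U p \<odot> (mat 1 \<otimes>\<^sub>b Lambda (- 1))
             - U p \<odot> (mat 1 \<otimes>\<^sub>b Omat1) \<odot> U p = 0"
    and "\<And>z p. z \<in> Z \<Longrightarrow> p \<in> D \<Longrightarrow> invertible (\<rho> z p)"
    and "\<And>z p. z \<in> Z \<Longrightarrow> p \<in> D \<Longrightarrow> differentiable_xy (\<rho> z) p"
    and "\<And>z p k. z \<in> Z \<Longrightarrow> p \<in> D \<Longrightarrow> k \<ge> 1 \<Longrightarrow>
           pdx k (\<rho> z) p - mscale z (pdx (k - 1) (\<rho> z) p) = 0"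
    and "\<And>z p k. z \<in> Z \<Longrightarrow> p \<in> D \<Longrightarrow> k \<ge> 1 \<Longrightarrow>
           pdy k (\<rho> z) p - mscale z (pdy (k - 1) (\<rho> z) p) = 0"
  shows "\<forall>p\<in>D. \<forall>k\<ge>1.
      leibniz Z (pdx k) (u_col U \<rho>) p =
        bmult_formal (shift_op (U p)) (leibniz Z (pdx (k - 1)) (u_col U \<rho>) p) \<and>
      leibniz Z (pdy k) (u_col U \<rho>) p =
        bmult_formal (shift_op (U p)) (leibniz Z (pdy (k - 1)) (u_col U \<rho>) p) \<and>
      leibniz Z (pdx k) (u_bar_col U \<rho>) p =
        bmult_formal (shift_op (U p)) (leibniz Z (pdx (k - 1)) (u_bar_col U \<rho>) p) \<and>
      leibniz Z (pdy k) (u_bar_col U \<rho>) p =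
        bmult_formal (shift_op (U p)) (leibniz Z (pdy (k - 1)) (u_bar_col U \<rho>) p)"
proof (intro ballI allI impI)
  fix p and k :: nat
  assume p: "p \<in> D" and k: "k \<ge> 1"
  have \<rho>x: "pdx k (\<rho> z) p = mscale z (pdx (k - 1) (\<rho> z) p)"
    and \<rho>y: "pdy k (\<rho> z) p = mscale z (pdy (k - 1) (\<rho> z) p)" if "z \<in> Z" for z
    using assms(9,10)[OF that p k] by simp_all
  \<comment> \<open>Each differentiation rule appears twice, once for index \<open>k\<close> and
    once for \<open>k - 1\<close>.\<close>
  note x = leibniz_u_col[of "pdx k" p "pdx (k - 1)" U Z \<rho>, OF pdx_const pdx_const
      pdx_const_add[OF assms(3)[OF p]] pdx_const_add[OF assms(3)[OF p]]
      pdx_const_diff[OF assms(3)[OF p]] pdx_const_diff[OF assms(3)[OF p]]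
      assms(4)[OF p k] assms(6)[OF p] \<rho>x]
  note y = leibniz_u_col[of "pdy k" p "pdy (k - 1)" U Z \<rho>, OF pdy_const pdy_const
      pdy_const_add[OF assms(3)[OF p]] pdy_const_add[OF assms(3)[OF p]]
      pdy_const_diff[OF assms(3)[OF p]] pdy_const_diff[OF assms(3)[OF p]]
      assms(5)[OF p k] assms(6)[OF p] \<rho>y]
  show "leibniz Z (pdx k) (u_col U \<rho>) p =
        bmult_formal (shift_op (U p)) (leibniz Z (pdx (k - 1)) (u_col U \<rho>) p) \<and>
      leibniz Z (pdy k) (u_col U \<rho>) p =
        bmult_formal (shift_op (U p)) (leibniz Z (pdy (k - 1)) (u_col U \<rho>) p) \<and>
      leibniz Z (pdx k) (u_bar_col U \<rho>) p =
        bmult_formal (shift_op (U p)) (leibniz Z (pdx (k - 1)) (u_bar_col U \<rho>) p) \<and>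
      leibniz Z (pdy k) (u_bar_col U \<rho>) p =
        bmult_formal (shift_op (U p)) (leibniz Z (pdy (k - 1)) (u_bar_col U \<rho>) p)"
    using x y by blast
qed

end
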